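(* Fix $\theta,\tau\in\mathbb{R}$, $b>0$ and $\kappa>0$, and set $q=F(\tau-\theta)$. Let $$\upsilon_\theta^{(1)}=\Big[1-\tfrac12 q\Big]\ln\frac{2-q}{1-q}-\ln 2,\qquad \upsilon_\theta^{(2)}=\tfrac12[1+q]\ln\frac{1+q}{q}-\ln2,$$ $$\upsilon_\theta^*=\min\{\upsilon_\theta^{(1)},\upsilon_\theta^{(2)}\}>0,\qquad \epsilon^*=\tfrac12\min\{q,1-q\}.$$ Let $T_G$ be the stopping time of the generalized CUSUM test with threshold $h$ (defined in the context) for a network of $N$ sensors with a secure period of length $M$. If $MN>\dfrac{\ln 2}{\upsilon_\theta^*}$, then $\mathbb{E}_\infty\{T_G\}\ge\kappa$ as long as $$h\ge N\left(\frac{\kappa}{1-2e^{-\upsilon_\theta^*MN}}+M\right)\ln\frac{1}{\epsilon^*}.$$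
   Context: Model. $\mathcal{N}$ is a set of $N\ge1$ sensors, partitioned into a set $\mathcal{S}$ of secure sensors (possibly empty) and a set $\mathcal{A}=\mathcal{N}\setminus\mathcal{S}$ of insecure sensors. $F$ is the common cdf of the i.i.d. additive noise; $F$ is invertible, i.e. a continuous strictly increasing bijection $\mathbb{R}\to(0,1)$. $\tau\in\mathbb{R}$ is the quantizer threshold, $\theta\in\mathbb{R}$ is an unknown deterministic parameter, and $b>0$ is a prescribed constant. Without attack, sensor $j$ at each time observes $x=\theta+n$ (noise $n$ with cdf $F$) and outputs the bit $\mathbf{1}\{x>\tau\}$. The bits during an initial secure period of length $M\ge1$ are denoted $\check u_j^{(m)}$ ($m=1,\dots,M$), and the bits after the secure period are relabeled $u_j^{(k)}$ ($k=1,2,\dots$), $j\in\mathcal{N}$. One-sample likelihoods, for $u\in\{0,1\}$: $\mathbb{P}_0(0\mid\theta)=F(\tau-\theta)$, $\mathbb{P}_0(1\mid\theta)=1-F(\tau-\theta)$, and $\mathbb{P}_1(0\mid\theta,\mu)=F(\tau-\theta-\mu)$, $\mathbb{P}_1(1\mid\theta,\mu)=1-F(\tau-\theta-\mu)$. $\mathbb{E}_\infty$ is expectation under the no-attack measure with parameter $\theta$: all bits $\check u_j^{(m)},u_j^{(k)}$ are i.i.d. and equal $0$ with probability $F(\tau-\theta)$. Generalized CUSUM test. For $1\le k\le K$, let $\Lambda_G^{(k,K)}=\sup_{\vartheta\in\mathbb{R},\,\mu_j\ge b\,(j\in\mathcal{A})}f_1(\vartheta,\{\mu_j\})-\sup_{\vartheta\in\mathbb{R}}f_0(\vartheta)$,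 where $$f_1(\vartheta,\{\mu_j\})=\sum_{m=1}^M\sum_{j\in\mathcal{N}}\ln\mathbb{P}_0(\check u_j^{(m)}\mid\vartheta)+\sum_{i=1}^K\sum_{j\in\mathcal{S}}\ln\mathbb{P}_0(u_j^{(i)}\mid\vartheta)+\sum_{i=1}^{k-1}\sum_{j\in\mathcal{A}}\ln\mathbb{P}_0(u_j^{(i)}\mid\vartheta)+\sum_{i=k}^K\sum_{j\in\mathcal{A}}\ln\mathbb{P}_1(u_j^{(i)}\mid\vartheta,\mu_j),$$ $$f_0(\vartheta)=\sum_{m=1}^M\sum_{j\in\mathcal{N}}\ln\mathbb{P}_0(\check u_j^{(m)}\mid\vartheta)+\sum_{i=1}^K\sum_{j\in\mathcal{N}}\ln\mathbb{P}_0(u_j^{(i)}\mid\vartheta).$$ For a threshold $h$, $T_G=\min\{K\ge1:\max_{1\le k\le K}\Lambda_G^{(k,K)}\ge h\}$ (with $\min\emptyset=\infty$). *)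

theory Defs
  imports "HOL-Probability.Probability"
begin

text \<open>
  A quantized bit is a \<open>bool\<close>, with \<open>True\<close> standing for 1 and \<open>False\<close> for 0.
  Sensors are elements of a type \<open>'s\<close>; in a realization of the observations, \<open>v j m\<close> is the
  \<open>m\<close>-th bit of sensor \<open>j\<close> in the secure period and \<open>u j k\<close> its \<open>k\<close>-th bit afterwards
  (both indexed from 1).
\<close>

text \<open>These conditions make \<open>F\<close> the distribution function of a real random variable, since
  monotonicity and surjectivity onto the open unit interval give the limits 0 and 1 at infinity.\<close>

definition invertible_cdf :: "(real \<Rightarrow> real) \<Rightarrow> bool" where
  "invertible_cdf F \<longleftrightarrow>
     continuous_on UNIV F \<and> strict_mono F \<and> bij_betw F UNIV {0<..<1}"

definition lik0 :: "(real \<Rightarrow> real) \<Rightarrow> real \<Rightarrow> bool \<Rightarrow> real \<Rightarrow> real" where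
  "lik0 F \<tau> x \<theta> = (if x then 1 - F (\<tau> - \<theta>) else F (\<tau> - \<theta>))"

definition lik1 :: "(real \<Rightarrow> real) \<Rightarrow> real \<Rightarrow> bool \<Rightarrow> real \<Rightarrow> real \<Rightarrow> real" where
  "lik1 F \<tau> x \<theta> \<mu> = (if x then 1 - F (\<tau> - \<theta> - \<mu>) else F (\<tau> - \<theta> - \<mu>))"

definition loglik1 ::
  "(real \<Rightarrow> real) \<Rightarrow> real \<Rightarrow> 's set \<Rightarrow> 's set \<Rightarrow> nat \<Rightarrow> ('s \<Rightarrow> nat \<Rightarrow> bool) \<Rightarrow> ('s \<Rightarrow> nat \<Rightarrow> bool)
    \<Rightarrow> nat \<Rightarrow> nat \<Rightarrow> real \<Rightarrow> ('s \<Rightarrow> real) \<Rightarrow> real" where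
  "loglik1 F \<tau> S A M v u k K \<theta> \<mu> =
     (\<Sum>m = 1..M. \<Sum>j \<in> S \<union> A. ln (lik0 F \<tau> (v j m) \<theta>))
   + (\<Sum>i = 1..K. \<Sum>j \<in> S. ln (lik0 F \<tau> (u j i) \<theta>))
   + (\<Sum>i = 1..<k. \<Sum>j \<in> A. ln (lik0 F \<tau> (u j i) \<theta>))
   + (\<Sum>i = k..K. \<Sum>j \<in> A. ln (lik1 F \<tau> (u j i) \<theta> (\<mu> j)))"

definition loglik0 ::
  "(real \<Rightarrow> real) \<Rightarrow> real \<Rightarrow> 's set \<Rightarrow> 's set \<Rightarrow> nat \<Rightarrow> ('s \<Rightarrow> nat \<Rightarrow> bool) \<Rightarrow> ('s \<Rightarrow> nat \<Rightarrow> bool)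
    \<Rightarrow> nat \<Rightarrow> real \<Rightarrow> real" where
  "loglik0 F \<tau> S A M v u K \<theta> =
     (\<Sum>m = 1..M. \<Sum>j \<in> S \<union> A. ln (lik0 F \<tau> (v j m) \<theta>))
   + (\<Sum>i = 1..K. \<Sum>j \<in> S \<union> A. ln (lik0 F \<tau> (u j i) \<theta>))"

text \<open>For an invertible \<open>F\<close> both suprema range over nonempty sets of nonpositive reals, so the
  real-valued supremum is the genuine one. The constraint on \<open>\<mu>\<close> concerns insecure sensors only;
  its values elsewhere do not enter \<open>loglik1\<close>.\<close>

definition gen_loglik_ratio ::
  "(real \<Rightarrow> real) \<Rightarrow> real \<Rightarrow> real \<Rightarrow> 's set \<Rightarrow> 's set \<Rightarrow> nat \<Rightarrow> ('s \<Rightarrow> nat \<Rightarrow> bool) \<Rightarrow> ('s \<Rightarrow> nat \<Rightarrow> bool)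
    \<Rightarrow> nat \<Rightarrow> nat \<Rightarrow> real" where
  "gen_loglik_ratio F \<tau> b S A M v u k K =
     Sup {loglik1 F \<tau> S A M v u k K \<theta> \<mu> | \<theta> \<mu>. \<forall>j\<in>A. b \<le> \<mu> j}
   - (SUP \<theta>. loglik0 F \<tau> S A M v u K \<theta>)"

text \<open>The infimum of the empty set in \<open>enat\<close> is \<open>\<infinity>\<close>.\<close>

definition gen_cusum_time ::
  "(real \<Rightarrow> real) \<Rightarrow> real \<Rightarrow> real \<Rightarrow> 's set \<Rightarrow> 's set \<Rightarrow> nat \<Rightarrow> real
    \<Rightarrow> ('s \<Rightarrow> nat \<Rightarrow> bool) \<Rightarrow> ('s \<Rightarrow> nat \<Rightarrow> bool) \<Rightarrow> enat" where
  "gen_cusum_time F \<tau> b S A M h v u =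
     (INF K \<in> {K. 1 \<le> K \<and> h \<le> (MAX k\<in>{1..K}. gen_loglik_ratio F \<tau> b S A M v u k K)}. enat K)"

text \<open>
  The law of the bits without attack: under the probability measure \<open>P\<close>, the random bits
  \<open>V j m\<close> (\<open>1 \<le> m \<le> M\<close>) and \<open>U j k\<close> (\<open>1 \<le> k\<close>) of the sensors in \<open>Ns\<close> are all mutually
  independent, and each of them is 0 with probability \<open>F (\<tau> - \<theta>)\<close>.
\<close>

definition no_attack_bits ::
  "(real \<Rightarrow> real) \<Rightarrow> real \<Rightarrow> real \<Rightarrow> 's set \<Rightarrow> nat \<Rightarrow> 'w measure
    \<Rightarrow> ('s \<Rightarrow> nat \<Rightarrow> 'w \<Rightarrow> bool) \<Rightarrow> ('s \<Rightarrow> nat \<Rightarrow> 'w \<Rightarrow> bool) \<Rightarrow> bool" where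
  "no_attack_bits F \<tau> \<theta> Ns M P V U \<longleftrightarrow>
     prob_space P \<and>
     prob_space.indep_vars P (\<lambda>_. count_space UNIV)
       (case_sum (\<lambda>(j, m). V j m) (\<lambda>(j, k). U j k)) ((Ns \<times> {1..M}) <+> (Ns \<times> {1..})) \<and>
     (\<forall>j\<in>Ns. \<forall>m\<in>{1..M}. measure P {w \<in> space P. V j m w = False} = F (\<tau> - \<theta>)) \<and>
     (\<forall>j\<in>Ns. \<forall>k\<in>{1..}. measure P {w \<in> space P. U j k w = False} = F (\<tau> - \<theta>))"

definition upsilon1 :: "real \<Rightarrow> real" where
  "upsilon1 q = (1 - q / 2) * ln ((2 - q) / (1 - q)) - ln 2"

definition upsilon2 :: "real \<Rightarrow> real" where
  "upsilon2 q = (1 / 2) * (1 + q) * ln ((1 + q) / q) - ln 2"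

definition upsilon_star :: "real \<Rightarrow> real" where
  "upsilon_star q = min (upsilon1 q) (upsilon2 q)"

definition eps_star :: "real \<Rightarrow> real" where
  "eps_star q = (1 / 2) * min q (1 - q)"

end

theory Submission
  imports Defs
begin

text \<open>
  The log-likelihood under attack never exceeds 0, whereas evaluating the attack-free
  log-likelihood at the parameter where a bit is 0 with probability \<open>1/2\<close> gives
  \<open>- N (M + K) ln 2\<close>. Hence the generalized likelihood ratio is at most \<open>N (M + K) ln 2\<close> on every
  realization. As \<open>eps_star q \<le> 1/4\<close>, the threshold cannot be reached before time \<open>\<kappa>\<close>, so the bound
  on the mean holds pathwise.
\<close>

lemma invertible_cdf_bounds:
  assumes "invertible_cdf F"
  shows "0 < F x" "F x < 1"
proof -
  have "F x \<in> {0<..<1}"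
    using assms unfolding invertible_cdf_def by (blast dest: bij_betwE)
  then show "0 < F x" "F x < 1" by auto
qed

lemma ln_lik0_nonpos:
  assumes "invertible_cdf F"
  shows "ln (lik0 F \<tau> x \<theta>) \<le> 0"
  using invertible_cdf_bounds[OF assms, of "\<tau> - \<theta>"] by (simp add: lik0_def)

lemma ln_lik1_nonpos:
  assumes "invertible_cdf F"
  shows "ln (lik1 F \<tau> x \<theta> \<mu>) \<le> 0"
  using invertible_cdf_bounds[OF assms, of "\<tau> - \<theta> - \<mu>"] by (simp add: lik1_def)

lemma loglik1_nonpos:
  assumes "invertible_cdf F"
  shows "loglik1 F \<tau> S A M v u k K \<theta> \<mu> \<le> 0"
  unfolding loglik1_def
  by (intro add_nonpos_nonpos sum_nonpos ln_lik0_nonpos ln_lik1_nonpos assms)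

lemma loglik0_nonpos:
  assumes "invertible_cdf F"
  shows "loglik0 F \<tau> S A M v u K \<theta> \<le> 0"
  unfolding loglik0_def
  by (intro add_nonpos_nonpos sum_nonpos ln_lik0_nonpos assms)

lemma loglik0_fair:
  assumes "F (\<tau> - \<theta>) = 1 / 2"
  shows "loglik0 F \<tau> S A M v u K \<theta> = - (real (card (S \<union> A)) * (real K + real M) * ln 2)"
proof -
  have "ln (lik0 F \<tau> x \<theta>) = - ln 2" for x
    unfolding lik0_def assms by (simp add: ln_div)
  then show ?thesis
    by (simp add: loglik0_def algebra_simps)
qed

text \<open>The bound is uniform in the change point \<open>k\<close> and in the bits, so it
  survives the maximum over \<open>k\<close> in the stopping rule.\<close>

lemma gen_loglik_ratio_le:
  assumes F: "invertible_cdf F"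
  shows "gen_loglik_ratio F \<tau> b S A M v u k K \<le> real (card (S \<union> A)) * (real K + real M) * ln 2"
proof -
  \<comment> \<open>Surjectivity onto the open unit interval provides a median \<open>x\<close> of
    \<open>F\<close>; the parameter \<open>\<tau> - x\<close> then makes each bit a fair
    coin.\<close>
  have "(1 / 2 :: real) \<in> range F"
    using F by (simp add: invertible_cdf_def bij_betw_def)
  then obtain x where "F x = 1 / 2" by (metis imageE)
  then have fair: "F (\<tau> - (\<tau> - x)) = 1 / 2" by simp
  have "Sup {loglik1 F \<tau> S A M v u k K \<theta> \<mu> | \<theta> \<mu>. \<forall>j\<in>A. b \<le> \<mu> j} \<le> 0"
  proof (rule cSup_least)
    \<comment> \<open>A real \<open>Sup\<close> can be bounded by its members only for a nonempty
      set; the constant shift \<open>b\<close> is admissible for every sensor.\<close>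
    have "loglik1 F \<tau> S A M v u k K 0 (\<lambda>_. b)
        \<in> {loglik1 F \<tau> S A M v u k K \<theta> \<mu> | \<theta> \<mu>. \<forall>j\<in>A. b \<le> \<mu> j}" by blast
    then show "{loglik1 F \<tau> S A M v u k K \<theta> \<mu> | \<theta> \<mu>. \<forall>j\<in>A. b \<le> \<mu> j} \<noteq> {}" by blast
  qed (auto intro: loglik1_nonpos[OF F])
  \<comment> \<open>Nonpositivity bounds the family above, so its supremum dominates the value at
    \<open>\<tau> - x\<close>.\<close>
  moreover have "loglik0 F \<tau> S A M v u K (\<tau> - x) \<le> (SUP \<theta>. loglik0 F \<tau> S A M v u K \<theta>)"
    by (rule cSUP_upper) (auto intro!: bdd_aboveI[of _ 0] loglik0_nonpos[OF F])
  ultimately show ?thesis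
    by (simp add: gen_loglik_ratio_def loglik0_fair[where F = F, OF fair])
qed

text \<open>A finite stopping time is itself a crossing time, and the maximum there is attained at
  some \<open>k\<close>; it thus suffices to bound \<open>K\<close> for a single pair
  \<open>(k, K)\<close>. If there is no crossing, the time is infinite.\<close>

lemma gen_cusum_time_ge:
  assumes "\<And>K k. 1 \<le> k \<Longrightarrow> k \<le> K \<Longrightarrow> h \<le> gen_loglik_ratio F \<tau> b S A M v u k K \<Longrightarrow> c \<le> real K"
  shows "ennreal c \<le> ennreal_of_enat (gen_cusum_time F \<tau> b S A M h v u)"
proof -
  define X where
    "X = {K. 1 \<le> K \<and> h \<le> (MAX k\<in>{1..K}. gen_loglik_ratio F \<tau> b S A M v u k K)}"
  have T: "gen_cusum_time F \<tau> b S A M h v u = Inf (enat ` X)"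
    by (simp add: gen_cusum_time_def X_def)
  show ?thesis
  proof (cases "X = {}")
    case True
    then show ?thesis by (simp add: T Inf_enat_def)
  next
    case False
    then have "Inf (enat ` X) \<in> enat ` X"
      by (auto simp: Inf_enat_def intro: LeastI)
    then obtain K where K: "K \<in> X" "Inf (enat ` X) = enat K" by auto
    then have "1 \<le> K" and h: "h \<le> (MAX k\<in>{1..K}. gen_loglik_ratio F \<tau> b S A M v u k K)"
      by (auto simp: X_def)
    then have "(MAX k\<in>{1..K}. gen_loglik_ratio F \<tau> b S A M v u k K)
        \<in> (\<lambda>k. gen_loglik_ratio F \<tau> b S A M v u k K) ` {1..K}"
      by (intro Max_in) auto
    then obtain k where "k \<in> {1..K}" "h \<le> gen_loglik_ratio F \<tau> b S A M v u k K"
      using h by (metis (no_types, lifting) imageE)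
    then have "c \<le> real K" using assms by auto
    then show ?thesis
      by (simp add: T K(2) ennreal_leI flip: ennreal_of_nat_eq_real_of_nat)
  qed
qed

text \<open>This quantity is the Kullback-Leibler divergence of a Bernoulli law with parameter
  \<open>q / 2\<close> from one with parameter \<open>q\<close>. Positivity follows from
  \<open>ln x \<le> x - 1\<close> together with \<open>ln 2 < 1\<close>.\<close>

lemma upsilon1_pos:
  assumes "0 < q" "q < 1"
  shows "0 < upsilon1 q"
proof -
  have "ln ((1 - q) / (1 - q / 2)) \<le> (1 - q) / (1 - q / 2) - 1"
    using assms by (intro ln_le_minus_one) auto
  then have "(1 - q / 2) * ln ((1 - q) / (1 - q / 2)) \<le> (1 - q / 2) * ((1 - q) / (1 - q / 2) - 1)"
    using assms by (intro mult_left_mono) auto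
  also have "\<dots> = - q / 2"
    using assms by (simp add: field_simps)
  finally have 1: "(1 - q / 2) * ln ((1 - q) / (1 - q / 2)) \<le> - q / 2" .
  \<comment> \<open>Extracting the factor 2 leaves the reciprocal of the ratio whose logarithm was
    just bounded.\<close>
  have "(2 - q) / (1 - q) = 2 * ((1 - q / 2) / (1 - q))"
    using assms by (simp add: field_simps)
  then have "ln ((2 - q) / (1 - q)) = ln 2 + ln ((1 - q / 2) / (1 - q))"
    using assms by (simp only: ln_mult_pos divide_pos_pos)
  also have "\<dots> = ln 2 - ln ((1 - q) / (1 - q / 2))"
    using assms by (simp add: ln_div)
  finally have ln_eq: "ln ((2 - q) / (1 - q)) = ln 2 - ln ((1 - q) / (1 - q / 2))" .
  have "upsilon1 q = - ((1 - q / 2) * ln ((1 - q) / (1 - q / 2))) - q / 2 * ln 2"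
    unfolding upsilon1_def ln_eq by (simp add: algebra_simps)
  moreover have "q / 2 * ln 2 < q / 2"
    using assms ln_2_less_1 by simp
  ultimately show ?thesis using 1 by linarith
qed

text \<open>Exchanging the bit values 0 and 1 replaces \<open>q\<close> by \<open>1 - q\<close>,
  which carries positivity over to the second exponent.\<close>

lemma upsilon2_eq_upsilon1: "upsilon2 q = upsilon1 (1 - q)"
  by (simp add: upsilon1_def upsilon2_def field_simps)

lemma upsilon_star_pos:
  assumes "0 < q" "q < 1"
  shows "0 < upsilon_star q"
  using assms by (simp add: upsilon_star_def upsilon2_eq_upsilon1 upsilon1_pos)

lemma ln_inverse_eps_star_ge:
  assumes "0 < q" "q < 1"
  shows "ln 2 \<le> ln (1 / eps_star q)"
proof -
  have "0 < eps_star q" "eps_star q \<le> 1 / 4"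
    using assms by (auto simp: eps_star_def min_def)
  then have "2 \<le> 1 / eps_star q" by (simp add: field_simps)
  then show ?thesis by (intro ln_mono) auto
qed

theorem theorem2:
  fixes F :: "real \<Rightarrow> real" and \<theta> \<tau> b \<kappa> q h :: real and M :: nat
    and Ns S A :: "'s set" and P :: "'w measure"
    and V U :: "'s \<Rightarrow> nat \<Rightarrow> 'w \<Rightarrow> bool"
  assumes sensors: "finite Ns" "1 \<le> card Ns"
    and partition: "S \<subseteq> Ns" "A = Ns - S"
    and F: "invertible_cdf F"
    and M: "1 \<le> M"
    and b: "0 < b" and \<kappa>: "0 < \<kappa>"
    and q: "q = F (\<tau> - \<theta>)"
    and bits: "no_attack_bits F \<tau> \<theta> Ns M P V U"
  shows "0 < upsilon_star q \<and>
    (ln 2 / upsilon_star q < real M * real (card Ns) \<longrightarrow>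
     real (card Ns)
       * (\<kappa> / (1 - 2 * exp (- upsilon_star q * real M * real (card Ns))) + real M)
       * ln (1 / eps_star q) \<le> h \<longrightarrow>
     ennreal \<kappa> \<le>
       (\<integral>\<^sup>+ w. ennreal_of_enat
           (gen_cusum_time F \<tau> b S A M h (\<lambda>j m. V j m w) (\<lambda>j k. U j k w)) \<partial>P))"
proof (intro conjI impI)
  have q01: "0 < q" "q < 1"
    using invertible_cdf_bounds[OF F] by (auto simp: q)
  show pos: "0 < upsilon_star q"
    using upsilon_star_pos q01 .
  let ?N = "real (card Ns)"
  define c where "c = 1 - 2 * exp (- upsilon_star q * real M * ?N)"
  assume "ln 2 / upsilon_star q < real M * ?N"
  then have "ln 2 < upsilon_star q * real M * ?N"
    using pos by (simp add: field_simps)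
  \<comment> \<open>The lower bound on \<open>M N\<close> says exactly that this exponential is
    below \<open>1/2\<close>, which makes the denominator \<open>c\<close> positive.\<close>
  then have "exp (- upsilon_star q * real M * ?N) < exp (- ln 2)"
    by (subst exp_less_cancel_iff) simp
  then have c: "0 < c" "c \<le> 1"
    by (auto simp: c_def exp_minus)
  then have "\<kappa> \<le> \<kappa> / c"
    using \<kappa> by (simp add: field_simps)
  assume "?N * (\<kappa> / (1 - 2 * exp (- upsilon_star q * real M * ?N)) + real M)
            * ln (1 / eps_star q) \<le> h"
  then have h: "?N * (\<kappa> / c + real M) * ln (1 / eps_star q) \<le> h"
    by (simp add: c_def)
  \<comment> \<open>Both replacements, \<open>\<kappa> / c\<close> by \<open>\<kappa>\<close> and
    the logarithm by \<open>ln 2\<close>, only lower the threshold, bringing it to the form of the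
    bound on the ratio.\<close>
  have "?N * (\<kappa> + real M) * ln 2 \<le> ?N * (\<kappa> / c + real M) * ln (1 / eps_star q)"
    using \<open>\<kappa> \<le> \<kappa> / c\<close> ln_inverse_eps_star_ge[OF q01] \<kappa> c
    by (intro mult_mono) auto
  with h have h: "?N * (\<kappa> + real M) * ln 2 \<le> h" by linarith
  have SA: "S \<union> A = Ns" using partition by auto
  have reach: "\<kappa> \<le> real K" if "h \<le> gen_loglik_ratio F \<tau> b S A M v u k K" for v u k K
  proof -
    have "?N * (\<kappa> + real M) * ln 2 \<le> ?N * (real K + real M) * ln 2"
      using h that gen_loglik_ratio_le[OF F, of \<tau> b S A M v u k K] by (simp add: SA)
    \<comment> \<open>At least one sensor is present, so the positive factor
      \<open>?N * ln 2\<close> cancels.\<close>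
    then show ?thesis using sensors(2) by simp
  qed
  interpret prob_space P
    using bits by (simp add: no_attack_bits_def)
  \<comment> \<open>Total mass 1 turns the pathwise bound into one on the mean.\<close>
  have "ennreal \<kappa> = (\<integral>\<^sup>+ w. ennreal \<kappa> \<partial>P)"
    by (simp add: emeasure_space_1)
  also have "\<dots> \<le> (\<integral>\<^sup>+ w. ennreal_of_enat
      (gen_cusum_time F \<tau> b S A M h (\<lambda>j m. V j m w) (\<lambda>j k. U j k w)) \<partial>P)"
    by (intro nn_integral_mono gen_cusum_time_ge reach)
  finally show "ennreal \<kappa> \<le> (\<integral>\<^sup>+ w. ennreal_of_enat
      (gen_cusum_time F \<tau> b S A M h (\<lambda>j m. V j m w) (\<lambda>j k. U j k w)) \<partial>P)" .
qed

end
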